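(* Let $J\ge 1$ be an integer, $h>0$, $\tau>0$, and let $D$ be the $(J+1)\times(J+1)$ central difference matrix given in the context. Suppose that the real vectors $U^n,V^n,P^n,Q^n\in\mathbb{R}^{J+1}$, $n=0,1,2,\dots$, satisfy the PAVF scheme for the Klein-Gordon-Schr\"odinger equation, that is, for all $n\ge 0$, $$ \begin{aligned} &\delta_t^+U^n=V^n+V^{n+1},\\ &\delta_t^+V^n=\tfrac12\big(DU^{n+\frac12}-U^{n+\frac12}+(P^n)^2+(Q^n)^2\big),\\ &\delta_t^+P^n=\tfrac12 DQ^{n+\frac12}+U^{n+1}\cdot Q^{n+\frac12},\\ &\delta_t^+Q^n=-\tfrac12 DP^{n+\frac12}-U^{n+1}\cdot P^{n+\frac12}. \end{aligned} $$ Then the scheme is mass and energy conservative: for all $n=1,2,\dots$, $$M(U^n,V^n,P^n,Q^n)=M(U^0,V^0,P^0,Q^0),\qquad H(U^n,V^n,P^n,Q^n)=H(U^0,V^0,P^0,Q^0),$$ where $M(U,V,P,Q)=\|P\|_J^2+\|Q\|_J^2$ and $$H(U,V,P,Q)=\frac14\Big(-P^TDP-Q^TDQ-U^TDU+U^TU+4V^TV-2\sum_{j=0}^{J}u_j\,(p_j^2+q_j^2)\Big).$$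
   Context: Background: the Klein-Gordon-Schr\"odinger system $i\varphi_t+\frac12\varphi_{xx}+u\varphi=0$, $u_{tt}-u_{xx}+u-|\varphi|^2=0$ on an interval $(x_L,x_R)$ with homogeneous Dirichlet boundary conditions is written with $\varphi=q+pi$, $v=\frac12u_t$, as $u_t=2v$, $v_t=\frac12(u_{xx}-u+p^2+q^2)$, $p_t=\frac12q_{xx}+uq$, $q_t=-\frac12p_{xx}-up$. It is discretized on the grid $x_j=x_L+jh$, $j=0,\dots,J$, $h=(x_R-x_L)/J$, with time step $\tau$. Notation: vectors are $U=(u_0,\dots,u_J)^T$, $V=(v_0,\dots,v_J)^T$, $P=(p_0,\dots,p_J)^T$, $Q=(q_0,\dots,q_J)^T$. $\delta_t^+W^n=(W^{n+1}-W^n)/\tau$ and $W^{n+\frac12}=\frac12(W^n+W^{n+1})$. The symbol $\cdot$ between vectors is the componentwise product, $P\cdot Q=(p_0q_0,\dots,p_Jq_J)^T$, and $P^2=P\cdot P$. The norm is $\|W\|_J=\big(h\sum_{j=0}^J|w_j|^2\big)^{1/2}$. $D$ is the second-order central difference matrix approximating $\partial_{xx}$ under homogeneous Dirichlet conditions: the symmetric tridiagonal $(J+1)\times(J+1)$ matrix with diagonal entries $-2/h^2$ and entries $1/h^2$ on the sub- and superdiagonals. *)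

theory Defs
  imports Complex_Main "Jordan_Normal_Form.Matrix"
begin

text \<open>
  Grid functions \<open>(w\<^sub>0, \<dots>, w\<^sub>J)\<close> are elements of \<open>carrier_vec (J + 1)\<close>, indexed from \<open>0\<close> to \<open>J\<close>.
\<close>

definition central_diff_mat :: "nat \<Rightarrow> real \<Rightarrow> real mat" where
  "central_diff_mat J h = mat (J + 1) (J + 1)
     (\<lambda>(i, j). if i = j then - 2 / h\<^sup>2
               else if i = j + 1 \<or> j = i + 1 then 1 / h\<^sup>2
               else 0)"

definition cprod :: "real vec \<Rightarrow> real vec \<Rightarrow> real vec"  (infixl \<open>\<odot>\<close> 70) where
  "v \<odot> w = vec (dim_vec v) (\<lambda>j. v $ j * w $ j)"

definition fwd_diff :: "real \<Rightarrow> (nat \<Rightarrow> real vec) \<Rightarrow> nat \<Rightarrow> real vec" where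
  "fwd_diff \<tau> W n = (1 / \<tau>) \<cdot>\<^sub>v (W (n + 1) - W n)"

text \<open>\<open>midpoint W n\<close> is \<open>W\<close> at the half step \<open>n + 1/2\<close>.\<close>

definition midpoint :: "(nat \<Rightarrow> real vec) \<Rightarrow> nat \<Rightarrow> real vec" where
  "midpoint W n = (1 / 2) \<cdot>\<^sub>v (W n + W (n + 1))"

definition grid_norm :: "nat \<Rightarrow> real \<Rightarrow> real vec \<Rightarrow> real" where
  "grid_norm J h W = sqrt (h * (\<Sum>j = 0..J. \<bar>W $ j\<bar>\<^sup>2))"

definition kgs_mass :: "nat \<Rightarrow> real \<Rightarrow> real vec \<Rightarrow> real vec \<Rightarrow> real vec \<Rightarrow> real vec \<Rightarrow> real" where
  "kgs_mass J h U V P Q = (grid_norm J h P)\<^sup>2 + (grid_norm J h Q)\<^sup>2"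

definition kgs_energy :: "nat \<Rightarrow> real \<Rightarrow> real vec \<Rightarrow> real vec \<Rightarrow> real vec \<Rightarrow> real vec \<Rightarrow> real" where
  "kgs_energy J h U V P Q = (let D = central_diff_mat J h in
     1 / 4 * (- (P \<bullet> (D *\<^sub>v P)) - Q \<bullet> (D *\<^sub>v Q) - U \<bullet> (D *\<^sub>v U)
              + U \<bullet> U + 4 * (V \<bullet> V)
              - 2 * (\<Sum>j = 0..J. U $ j * ((P $ j)\<^sup>2 + (Q $ j)\<^sup>2))))"

end

theory Submission
  imports Defs
begin

text \<open>
  For symmetric \<open>D\<close> one has \<open>y \<bullet> Dy - x \<bullet> Dx = 2 (y - x) \<bullet> Dm\<close> with \<open>m = (x + y) / 2\<close>. Substituting
  the scheme into the resulting energy increment makes the summand vanish at every single grid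
  point. The mass increment reduces to a multiple of \<open>p \<bullet> Dq - q \<bullet> Dp\<close>, where \<open>p\<close> and \<open>q\<close> are the
  midpoints of \<open>P\<close> and \<open>Q\<close>; this vanishes only after summation, by symmetry of \<open>D\<close>.
\<close>

lemma central_diff_mat_carrier: "central_diff_mat J h \<in> carrier_mat (J + 1) (J + 1)"
  by (simp add: central_diff_mat_def)

lemma transpose_central_diff_mat: "transpose_mat (central_diff_mat J h) = central_diff_mat J h"
  by (rule eq_matI) (auto simp: central_diff_mat_def)

text \<open>Moving \<open>A\<close> across the scalar product transposes it, and symmetry then
  removes the transpose.\<close>

lemma symmetric_mat_scalar_prod_commute:
  fixes A :: "'a :: comm_semiring_0 mat"
  assumes A: "A \<in> carrier_mat N N" and sym: "transpose_mat A = A"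
    and x: "x \<in> carrier_vec N" and y: "y \<in> carrier_vec N"
  shows "x \<bullet> (A *\<^sub>v y) = y \<bullet> (A *\<^sub>v x)"
proof -
  have "x \<bullet> (A *\<^sub>v y) = (A *\<^sub>v y) \<bullet> x"
    using A x y by (intro comm_scalar_prod[of _ N]) auto
  also have "\<dots> = y \<bullet> (A *\<^sub>v x)"
    using transpose_vec_mult_scalar[OF A x y] sym by simp
  finally show ?thesis .
qed

lemma midpoint_carrier [simp]:
  assumes "\<And>n. W n \<in> carrier_vec N"
  shows "midpoint W n \<in> carrier_vec N"
  using assms[of n] assms[of "n + 1"] by (simp add: midpoint_def)

lemma index_midpoint:
  assumes "\<And>n. W n \<in> carrier_vec N" "j < N"
  shows "midpoint W n $ j = (W n $ j + W (n + 1) $ j) / 2"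
  using assms(1)[of n] assms(1)[of "n + 1"] assms(2) by (simp add: midpoint_def)

lemma index_fwd_diff:
  assumes "\<And>n. W n \<in> carrier_vec N" "j < N"
  shows "fwd_diff \<tau> W n $ j = (W (n + 1) $ j - W n $ j) / \<tau>"
  using assms(1)[of n] assms(1)[of "n + 1"] assms(2) by (simp add: fwd_diff_def)

lemma index_cprod: "j < dim_vec v \<Longrightarrow> (v \<odot> w) $ j = v $ j * w $ j"
  by (simp add: cprod_def)

lemma dim_cprod [simp]: "dim_vec (v \<odot> w) = dim_vec v"
  by (simp add: cprod_def)

lemma scalar_prod_eq_sum:
  "w \<in> carrier_vec (J + 1) \<Longrightarrow> v \<bullet> w = (\<Sum>j = 0..J. v $ j * w $ j)"
  by (simp add: scalar_prod_def atLeastLessThanSuc_atLeastAtMost)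

text \<open>A discrete chain rule for quadratic forms: expanding
  \<open>(y - x) \<bullet> A (x + y)\<close> leaves the two diagonal terms, since the mixed terms
  cancel by symmetry. The result is a sum over grid points so that it can later be merged with the
  other energy terms and compared point by point.\<close>

lemma quadratic_form_increment:
  fixes W :: "nat \<Rightarrow> real vec"
  assumes A: "A \<in> carrier_mat (J + 1) (J + 1)" and sym: "transpose_mat A = A"
    and W: "\<And>n. W n \<in> carrier_vec (J + 1)"
  shows "W (n + 1) \<bullet> (A *\<^sub>v W (n + 1)) - W n \<bullet> (A *\<^sub>v W n) =
    (\<Sum>j = 0..J. 2 * (W (n + 1) $ j - W n $ j) * (A *\<^sub>v midpoint W n) $ j)"
proof -
  let ?x = "W n" and ?y = "W (n + 1)"
  have x: "?x \<in> carrier_vec (J + 1)" and y: "?y \<in> carrier_vec (J + 1)"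
    using W by blast+
  have Ax: "A *\<^sub>v ?x \<in> carrier_vec (J + 1)" and Ay: "A *\<^sub>v ?y \<in> carrier_vec (J + 1)"
    using A x y by auto
  have "(A *\<^sub>v midpoint W n) = (1 / 2) \<cdot>\<^sub>v (A *\<^sub>v ?x + A *\<^sub>v ?y)"
    unfolding midpoint_def using A x y
    by (simp add: mult_mat_vec[of A "J + 1" "J + 1"] mult_add_distrib_mat_vec[of A "J + 1" "J + 1"])
  then have comp: "(A *\<^sub>v midpoint W n) $ j = ((A *\<^sub>v ?x) $ j + (A *\<^sub>v ?y) $ j) / 2"
    if "j \<le> J" for j
    using that Ax Ay A by simp
  have "(\<Sum>j = 0..J. 2 * (?y $ j - ?x $ j) * (A *\<^sub>v midpoint W n) $ j) =
    (\<Sum>j = 0..J. ?y $ j * (A *\<^sub>v ?y) $ j + ?y $ j * (A *\<^sub>v ?x) $ j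
      - ?x $ j * (A *\<^sub>v ?y) $ j - ?x $ j * (A *\<^sub>v ?x) $ j)"
    by (intro sum.cong refl) (simp add: comp field_simps)
  also have "\<dots> = ?y \<bullet> (A *\<^sub>v ?y) + ?y \<bullet> (A *\<^sub>v ?x) - ?x \<bullet> (A *\<^sub>v ?y) - ?x \<bullet> (A *\<^sub>v ?x)"
    by (simp only: scalar_prod_eq_sum[OF Ax] scalar_prod_eq_sum[OF Ay]
        sum.distrib sum_subtractf)
  also have "\<dots> = ?y \<bullet> (A *\<^sub>v ?y) - ?x \<bullet> (A *\<^sub>v ?x)"
    using symmetric_mat_scalar_prod_commute[OF A sym x y] by simp
  finally show ?thesis by simp
qed

lemma grid_norm_squared: "h > 0 \<Longrightarrow> (grid_norm J h W)\<^sup>2 = h * (\<Sum>j = 0..J. (W $ j)\<^sup>2)"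
  by (simp add: grid_norm_def sum_nonneg)

theorem theorem3p1:
  fixes J :: nat and h \<tau> :: real
    and D :: "real mat"
    and U V P Q :: "nat \<Rightarrow> real vec"
  assumes "J \<ge> 1" and "h > 0" and "\<tau> > 0"
    and D: "D = central_diff_mat J h"
    and U_dim: "\<And>n. U n \<in> carrier_vec (J + 1)"
    and V_dim: "\<And>n. V n \<in> carrier_vec (J + 1)"
    and P_dim: "\<And>n. P n \<in> carrier_vec (J + 1)"
    and Q_dim: "\<And>n. Q n \<in> carrier_vec (J + 1)"
    and U_step: "\<And>n. fwd_diff \<tau> U n = V n + V (n + 1)"
    and V_step: "\<And>n. fwd_diff \<tau> V n =
      (1 / 2) \<cdot>\<^sub>v (D *\<^sub>v midpoint U n - midpoint U n + P n \<odot> P n + Q n \<odot> Q n)"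
    and P_step: "\<And>n. fwd_diff \<tau> P n =
      (1 / 2) \<cdot>\<^sub>v (D *\<^sub>v midpoint Q n) + U (n + 1) \<odot> midpoint Q n"
    and Q_step: "\<And>n. fwd_diff \<tau> Q n =
      (- 1 / 2) \<cdot>\<^sub>v (D *\<^sub>v midpoint P n) - U (n + 1) \<odot> midpoint P n"
  shows "\<forall>n\<ge>1. kgs_mass J h (U n) (V n) (P n) (Q n) = kgs_mass J h (U 0) (V 0) (P 0) (Q 0)
             \<and> kgs_energy J h (U n) (V n) (P n) (Q n) = kgs_energy J h (U 0) (V 0) (P 0) (Q 0)"
proof -
  have Dc: "D \<in> carrier_mat (J + 1) (J + 1)" and Dsym: "transpose_mat D = D"
    unfolding D by (rule central_diff_mat_carrier, rule transpose_central_diff_mat)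
  have Dmid: "D *\<^sub>v midpoint W n \<in> carrier_vec (J + 1)"
    if "\<And>n. W n \<in> carrier_vec (J + 1)" for W n
    using Dc midpoint_carrier[OF that] by simp
  have step: "kgs_mass J h (U (n + 1)) (V (n + 1)) (P (n + 1)) (Q (n + 1)) =
      kgs_mass J h (U n) (V n) (P n) (Q n)
    \<and> kgs_energy J h (U (n + 1)) (V (n + 1)) (P (n + 1)) (Q (n + 1)) =
      kgs_energy J h (U n) (V n) (P n) (Q n)" for n
  proof
    \<comment> \<open>Passing to components turns the scheme into polynomial identities between
      reals; primes mark the new time level.\<close>
    define u v p q u' v' p' q' where "u = ($) (U n)" and "v = ($) (V n)"
      and "p = ($) (P n)" and "q = ($) (Q n)" and "u' = ($) (U (n + 1))"
      and "v' = ($) (V (n + 1))" and "p' = ($) (P (n + 1))" and "q' = ($) (Q (n + 1))"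
    note comps = u_def v_def p_def q_def u'_def v'_def p'_def q'_def
    \<comment> \<open>The diffusion terms stay opaque reals. For this reason
      \<open>index_mult_mat_vec\<close> is removed from the simplifier below: it would unfold them
      into products with rows of \<open>D\<close>.\<close>
    define a b c where "a = ($) (D *\<^sub>v midpoint U n)" and "b = ($) (D *\<^sub>v midpoint P n)"
      and "c = ($) (D *\<^sub>v midpoint Q n)"
    note dims = carrier_vecD[OF U_dim] carrier_vecD[OF V_dim] carrier_vecD[OF P_dim]
      carrier_vecD[OF Q_dim] carrier_matD[OF Dc] carrier_vecD[OF midpoint_carrier[OF U_dim]]
      carrier_vecD[OF midpoint_carrier[OF P_dim]] carrier_vecD[OF midpoint_carrier[OF Q_dim]]
    have U_comp: "u' j - u j = \<tau> * (v j + v' j)" if "j \<le> J" for j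
      using arg_cong[OF U_step[of n], of "\<lambda>w. w $ j"] that \<open>\<tau> > 0\<close> dims
      by (simp add: index_fwd_diff[OF U_dim] comps field_simps)
    have V_comp: "v' j - v j = \<tau> / 2 * (a j - (u j + u' j) / 2 + (p j)\<^sup>2 + (q j)\<^sup>2)"
      if "j \<le> J" for j
      using arg_cong[OF V_step[of n], of "\<lambda>w. w $ j"] that \<open>\<tau> > 0\<close> dims
      by (simp add: index_fwd_diff[OF V_dim] index_midpoint[OF U_dim] index_cprod comps a_def
          power2_eq_square field_simps del: index_mult_mat_vec)
    have P_comp: "p' j - p j = \<tau> * (c j / 2 + u' j * ((q j + q' j) / 2))" if "j \<le> J" for j
      using arg_cong[OF P_step[of n], of "\<lambda>w. w $ j"] that \<open>\<tau> > 0\<close> dims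
      by (simp add: index_fwd_diff[OF P_dim] index_midpoint[OF Q_dim] index_cprod comps c_def
          field_simps del: index_mult_mat_vec)
    have Q_comp: "q' j - q j = - \<tau> * (b j / 2 + u' j * ((p j + p' j) / 2))" if "j \<le> J" for j
      using arg_cong[OF Q_step[of n], of "\<lambda>w. w $ j"] that \<open>\<tau> > 0\<close> dims
      by (simp add: index_fwd_diff[OF Q_dim] index_midpoint[OF P_dim] index_cprod comps b_def
          field_simps del: index_mult_mat_vec)

    have "(\<Sum>j = 0..J. (p j + p' j) / 2 * c j) = midpoint P n \<bullet> (D *\<^sub>v midpoint Q n)"
      unfolding scalar_prod_eq_sum[OF Dmid[OF Q_dim]]
      by (intro sum.cong) (auto simp: index_midpoint[OF P_dim] comps c_def)
    also have "\<dots> = midpoint Q n \<bullet> (D *\<^sub>v midpoint P n)"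
      by (intro symmetric_mat_scalar_prod_commute[OF Dc Dsym] midpoint_carrier P_dim Q_dim)
    also have "\<dots> = (\<Sum>j = 0..J. (q j + q' j) / 2 * b j)"
      unfolding scalar_prod_eq_sum[OF Dmid[OF P_dim]]
      by (intro sum.cong) (auto simp: index_midpoint[OF Q_dim] comps b_def)
    finally have sym_PQ:
      "(\<Sum>j = 0..J. (p j + p' j) / 2 * c j) - (\<Sum>j = 0..J. (q j + q' j) / 2 * b j) = 0"
      by simp
    have "(p' j)\<^sup>2 + (q' j)\<^sup>2 - ((p j)\<^sup>2 + (q j)\<^sup>2) =
        \<tau> * ((p j + p' j) / 2 * c j - (q j + q' j) / 2 * b j)" if "j \<le> J" for j
    proof -
      \<comment> \<open>After factoring the differences of squares, the coupling contributions
        \<open>u' j * (p j + p' j) * (q j + q' j) / 2\<close> enter with opposite signs and cancel,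
        leaving only the terms in \<open>b\<close> and \<open>c\<close>.\<close>
      have "(p' j)\<^sup>2 + (q' j)\<^sup>2 - ((p j)\<^sup>2 + (q j)\<^sup>2) =
          (p' j - p j) * (p j + p' j) + (q' j - q j) * (q j + q' j)"
        by (simp add: power2_eq_square algebra_simps)
      also have "\<dots> = \<tau> * ((p j + p' j) / 2 * c j - (q j + q' j) / 2 * b j)"
        unfolding P_comp[OF that] Q_comp[OF that] by (simp add: field_simps)
      finally show ?thesis .
    qed
    then have "(\<Sum>j = 0..J. (p' j)\<^sup>2 + (q' j)\<^sup>2 - ((p j)\<^sup>2 + (q j)\<^sup>2)) =
        \<tau> * ((\<Sum>j = 0..J. (p j + p' j) / 2 * c j) - (\<Sum>j = 0..J. (q j + q' j) / 2 * b j))"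
      unfolding sum_subtractf[symmetric] sum_distrib_left by (intro sum.cong) auto
    also have "\<dots> = 0"
      unfolding sym_PQ by simp
    finally have "h * (\<Sum>j = 0..J. (p' j)\<^sup>2) + h * (\<Sum>j = 0..J. (q' j)\<^sup>2) =
        h * (\<Sum>j = 0..J. (p j)\<^sup>2) + h * (\<Sum>j = 0..J. (q j)\<^sup>2)"
      by (simp add: sum.distrib sum_subtractf flip: distrib_left)
    then show "kgs_mass J h (U (n + 1)) (V (n + 1)) (P (n + 1)) (Q (n + 1)) =
        kgs_mass J h (U n) (V n) (P n) (Q n)"
      by (simp add: kgs_mass_def grid_norm_squared[OF \<open>h > 0\<close>] comps)

    \<comment> \<open>This is the summand of four times the energy increment, in exactly the shape
      in which the separate sums are collected below.\<close>
    have pointwise: "- (2 * (p' j - p j) * b j) - 2 * (q' j - q j) * c j - 2 * (u' j - u j) * a j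
        + ((u' j)\<^sup>2 - (u j)\<^sup>2) + 4 * ((v' j)\<^sup>2 - (v j)\<^sup>2)
        - 2 * (u' j * ((p' j)\<^sup>2 + (q' j)\<^sup>2) - u j * ((p j)\<^sup>2 + (q j)\<^sup>2)) = 0"
      (is "?e = 0") if "j \<le> J" for j
    proof -
      \<comment> \<open>The coupling increment is split with
        \<open>r = p\<^sup>2 + q\<^sup>2\<close> as
        \<open>u' r' - u r = u' (r' - r) + (u' - u) r\<close>. This matches the scheme, which uses
        the new \<open>u'\<close> in the equations for \<open>P\<close> and \<open>Q\<close> but the
        old \<open>r\<close> in that for \<open>V\<close>, so every bracket is a right-hand side of
        the scheme up to a factor.\<close>
      have "?e = - 4 * (p' j - p j) * (b j / 2 + u' j * ((p j + p' j) / 2))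
          - 4 * (q' j - q j) * (c j / 2 + u' j * ((q j + q' j) / 2))
          + 4 * (v' j - v j) * (v j + v' j)
          - 2 * (u' j - u j) * (a j - (u j + u' j) / 2 + (p j)\<^sup>2 + (q j)\<^sup>2)"
        by (simp add: power2_eq_square field_simps)
      \<comment> \<open>The first two products cancel because their brackets are
        \<open>- (q' j - q j) / \<tau>\<close> and \<open>(p' j - p j) / \<tau>\<close>. In the last
        two, both equal \<open>2 * \<tau> * (v j + v' j)\<close> times the same bracket, with
        opposite signs.\<close>
      also have "\<dots> = 0"
        unfolding U_comp[OF that] V_comp[OF that] P_comp[OF that] Q_comp[OF that]
        by (simp add: field_simps)
      finally show ?thesis .
    qed
    have square: "W m \<bullet> W m = (\<Sum>j = 0..J. (W m $ j)\<^sup>2)"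
      if "\<And>n. W n \<in> carrier_vec (J + 1)" for W :: "nat \<Rightarrow> real vec" and m
      using scalar_prod_eq_sum[OF that] by (simp add: power2_eq_square)
    note form = quadratic_form_increment[OF Dc Dsym, where n = n]
    \<comment> \<open>The factor 4 clears the \<open>1 / 4\<close> in the energy; the increment is
      grouped into differences of like terms so that \<open>form\<close> and \<open>square\<close>
      apply to each.\<close>
    have "4 * (kgs_energy J h (U (n + 1)) (V (n + 1)) (P (n + 1)) (Q (n + 1)) -
          kgs_energy J h (U n) (V n) (P n) (Q n)) =
        - (P (n + 1) \<bullet> (D *\<^sub>v P (n + 1)) - P n \<bullet> (D *\<^sub>v P n))
        - (Q (n + 1) \<bullet> (D *\<^sub>v Q (n + 1)) - Q n \<bullet> (D *\<^sub>v Q n))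
        - (U (n + 1) \<bullet> (D *\<^sub>v U (n + 1)) - U n \<bullet> (D *\<^sub>v U n))
        + (U (n + 1) \<bullet> U (n + 1) - U n \<bullet> U n) + 4 * (V (n + 1) \<bullet> V (n + 1) - V n \<bullet> V n)
        - 2 * ((\<Sum>j = 0..J. u' j * ((p' j)\<^sup>2 + (q' j)\<^sup>2)) - (\<Sum>j = 0..J. u j * ((p j)\<^sup>2 + (q j)\<^sup>2)))"
      unfolding kgs_energy_def Let_def D[symmetric] comps by (simp add: algebra_simps)
    also have "\<dots> = (\<Sum>j = 0..J.
        - (2 * (p' j - p j) * b j) - 2 * (q' j - q j) * c j - 2 * (u' j - u j) * a j
        + ((u' j)\<^sup>2 - (u j)\<^sup>2) + 4 * ((v' j)\<^sup>2 - (v j)\<^sup>2)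
        - 2 * (u' j * ((p' j)\<^sup>2 + (q' j)\<^sup>2) - u j * ((p j)\<^sup>2 + (q j)\<^sup>2)))"
      unfolding form[of P, OF P_dim] form[of Q, OF Q_dim] form[of U, OF U_dim]
        square[of U, OF U_dim] square[of V, OF V_dim] comps a_def b_def c_def
      by (simp only: sum.distrib sum_subtractf sum_negf sum_distrib_left[symmetric])
    also have "\<dots> = 0"
      using pointwise by (intro sum.neutral) auto
    finally show "kgs_energy J h (U (n + 1)) (V (n + 1)) (P (n + 1)) (Q (n + 1)) =
        kgs_energy J h (U n) (V n) (P n) (Q n)"
      by simp
  qed
  have "kgs_mass J h (U n) (V n) (P n) (Q n) = kgs_mass J h (U 0) (V 0) (P 0) (Q 0)
      \<and> kgs_energy J h (U n) (V n) (P n) (Q n) = kgs_energy J h (U 0) (V 0) (P 0) (Q 0)" for n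
    by (induction n) (use step in auto)
  then show ?thesis by blast
qed

end
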